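(* Let $k$ be a countably infinite field of characteristic zero. Then there exist formal power series $\gamma,\beta\in k[[t]]$ such that for the linear differential system $\Sigma=\{y''+\gamma(t)y'+\beta(t)y\}\subset k_{1,1}$ the following hold: the set of supports $\mathcal T(\mathrm{Sol}(\Sigma))\subset 2^{\mathbb N}$ is not closed under unions (hence is not the set of scrawls of a matroid on $\mathbb N$), and there is an element of $\mathrm{Sol}(\mathrm{trop}([\Sigma]))$, namely the full set $\mathbb N$, that does not belong to $\mathcal T(\mathrm{Sol}(\Sigma))$. In particular $\mathcal T(\mathrm{Sol}(\Sigma))\neq\mathrm{Sol}(\mathrm{trop}([\Sigma]))$, so the equality of the fundamental theorem of tropical differential algebraic geometry fails for $\Sigma$ over $k$.
   Context: $\mathbb N=\{0,1,2,\dots\}$. $k_{1,1}=k[[t]][y,y',y'',\dots]$ is the ring of differential polynomials in one differential indeterminate $y$ over $(k[[t]],d/dt)$. $\mathrm{Sol}(\Sigma)\subset k[[t]]$ is the set of power series solutions of $\Sigma$. $[\Sigma]$ is the differential ideal spanned by $\Sigma$ (smallest ideal of $k_{1,1}$ containing $\Sigma$ and closed under the derivation). For $w=\sum a_jt^j\in k[[t]]$, $\mathcal T(w)=\{j: a_j\ne0\}\subset\mathbb N$ and $\mathcal T(Y)=\{\mathcal T(w): w\in Y\}$ for $Y\subset k[[t]]$. Tropical side. $\mathbb B=\{0,1\}$ is the Boolean semifield ($1+1=1$); $\mathbb B[[t]]$ is identified with $2^{\mathbb N}$ via supports, with sum = union, product = Minkowski sum, and derivation $S\mapsto\{j-1: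 j\in S, j>0\}$. $\mathbb B_{1,1}=\mathbb B[[t]][y,y',y'',\dots]$; a differential monomial $E_M=\prod_j(y^{(j)})^{m_j}$ is evaluated at $\varphi\in\mathbb B[[t]]$ as $E_M(\varphi)=\prod_j(\varphi^{(j)})^{m_j}$. $V:\mathbb B[[t]]\to V\mathbb B[t]$ is the quotient semiring homomorphism identifying series with equal Newton polyhedra, where $\mathrm{New}(A)$ is the convex hull of $\{i+j: i\in A,j\in\mathbb N\}$; addition in $V\mathbb B[t]$ is $\oplus$. A sum $a_1\oplus\dots\oplus a_k$ tropically vanishes if it is unchanged by omitting any one summand (the empty sum being $0$). $\varphi$ is a solution of $p=\sum_Ma_ME_M\in\mathbb B_{1,1}$ if $\bigoplus_MV(a_ME_M(\varphi))$ tropically vanishes. For $P=\sum_Ma_ME_M\in k_{1,1}$, $\mathrm{trop}(P)=\sum_M\mathcal T(a_M)E_M$, and $\mathrm{Sol}(\mathrm{trop}([\Sigma]))\subset\mathbb B[[t]]\cong2^{\mathbb N}$ is the set of common solutions of all $\mathrm{trop}(P)$, $P\in[\Sigma]$. A set of scrawls of a matroid is in particular closed under arbitrary unions. The fundamental theorem (valid over uncountable algebraically closed fields of characteristic zero) asserts $\mathcal T(\mathrm{Sol}(\Sigma))=\mathrm{Sol}(\mathrm{trop}([\Sigma]))$. *)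

theory Defs
  imports
    "HOL-Analysis.Analysis"
    "HOL-Computational_Algebra.Formal_Power_Series"
    "HOL-Library.Poly_Mapping"
begin

abbreviation keys :: "('a \<Rightarrow>\<^sub>0 'b::zero) \<Rightarrow> 'a set" where "keys \<equiv> Poly_Mapping.keys"
abbreviation lookup :: "('a \<Rightarrow>\<^sub>0 'b::zero) \<Rightarrow> 'a \<Rightarrow> 'b" where "lookup \<equiv> Poly_Mapping.lookup"
abbreviation single :: "'a \<Rightarrow> 'b \<Rightarrow> 'a \<Rightarrow>\<^sub>0 'b::zero" where "single \<equiv> Poly_Mapping.single"

section \<open>Differential polynomials in one indeterminate\<close>

text \<open>
  A differential monomial \<open>\<Prod>j. (y^(j))^(m j)\<close> is its finitely supported exponent vector \<open>m\<close>;
  a differential polynomial is a finitely supported family of power series coefficients. The ring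
  structure is the monoid-algebra structure of \<^theory>\<open>HOL-Library.Poly_Mapping\<close>.
\<close>

type_synonym dmono = "nat \<Rightarrow>\<^sub>0 nat"
type_synonym 'a dpoly = "dmono \<Rightarrow>\<^sub>0 'a fps"

definition dconst :: "'a::zero fps \<Rightarrow> 'a dpoly" where
  "dconst a = single 0 a"

definition dvar :: "nat \<Rightarrow> 'a::{zero,one} dpoly" where
  "dvar j = single (single j 1) 1"

definition dmono_deriv :: "dmono \<Rightarrow> 'a::comm_semiring_1 dpoly" where
  "dmono_deriv M =
     (\<Sum>j\<in>keys M. single
        (M - single j 1 + single (Suc j) 1)
        (of_nat (lookup M j)))"

definition dderiv :: "'a::comm_semiring_1 dpoly \<Rightarrow> 'a dpoly" where
  "dderiv P =
     (\<Sum>M\<in>keys P.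
        single M (fps_deriv (lookup P M)) + dconst (lookup P M) * dmono_deriv M)"

definition dmono_eval :: "dmono \<Rightarrow> 'a::comm_semiring_1 fps \<Rightarrow> 'a fps" where
  "dmono_eval M w = (\<Prod>j\<in>keys M. ((fps_deriv ^^ j) w) ^ lookup M j)"

definition deval :: "'a::comm_semiring_1 dpoly \<Rightarrow> 'a fps \<Rightarrow> 'a fps" where
  "deval P w = (\<Sum>M\<in>keys P. lookup P M * dmono_eval M w)"

definition Sol :: "'a::comm_semiring_1 dpoly set \<Rightarrow> 'a fps set" where
  "Sol S = {w. \<forall>P\<in>S. deval P w = 0}"

definition diff_ideal :: "'a::comm_ring_1 dpoly set \<Rightarrow> bool" where
  "diff_ideal I \<longleftrightarrow>
     0 \<in> I \<and> (\<forall>P\<in>I. \<forall>Q\<in>I. P + Q \<in> I) \<and> (\<forall>R. \<forall>P\<in>I. R * P \<in> I) \<and> (\<forall>P\<in>I. dderiv P \<in> I)"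

definition diff_ideal_span :: "'a::comm_ring_1 dpoly set \<Rightarrow> 'a dpoly set" where
  "diff_ideal_span S = diff_ideal hull S"

text \<open>The derivation is characterised by the following facts.\<close>

lemma dderiv_single:
  "dderiv (single M a) =
     single M (fps_deriv a) + dconst a * dmono_deriv M"
  by (cases "a = 0") (simp_all add: dderiv_def dconst_def)

lemma dderiv_superset:
  assumes "finite A" "keys P \<subseteq> A"
  shows "dderiv P = (\<Sum>M\<in>A. dderiv (single M (lookup P M)))"
  unfolding dderiv_single unfolding dderiv_def
  by (rule sum.mono_neutral_left) (use assms in \<open>auto simp: in_keys_iff dconst_def\<close>)

lemma dderiv_add:
  fixes P Q :: "'a::comm_semiring_1 dpoly"
  shows "dderiv (P + Q) = dderiv P + dderiv Q"
proof -
  let ?A = "keys P \<union> keys Q"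
  have single: "dderiv (single M (a + b)) =
      dderiv (single M a) + dderiv (single M b)" for M and a b :: "'a fps"
  proof -
    have "fps_deriv (a + b) = fps_deriv a + fps_deriv b"
      by (simp add: fps_eq_iff algebra_simps)
    then show ?thesis
      unfolding dderiv_single by (simp add: single_add dconst_def algebra_simps)
  qed
  have "dderiv (P + Q) = (\<Sum>M\<in>?A. dderiv (single M (lookup (P + Q) M)))"
    by (rule dderiv_superset) (use keys_add[of P Q] in auto)
  also have "\<dots> = (\<Sum>M\<in>?A. dderiv (single M (lookup P M)))
                 + (\<Sum>M\<in>?A. dderiv (single M (lookup Q M)))"
    by (simp add: lookup_add single sum.distrib)
  also have "\<dots> = dderiv P + dderiv Q"
    using dderiv_superset[of ?A P] dderiv_superset[of ?A Q] by simp
  finally show ?thesis .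
qed

lemma dderiv_sum: "finite A \<Longrightarrow> dderiv (\<Sum>i\<in>A. f i) = (\<Sum>i\<in>A. dderiv (f i))"
  by (induction A rule: finite_induct) (simp_all add: dderiv_add, simp add: dderiv_def)

lemma dmono_deriv_superset:
  assumes "finite A" "keys M \<subseteq> A"
  shows "dmono_deriv M = (\<Sum>j\<in>A. single
        (M - single j 1 + single (Suc j) 1) (of_nat (lookup M j)))"
  unfolding dmono_deriv_def
  by (rule sum.mono_neutral_left) (use assms in \<open>auto simp: in_keys_iff\<close>)

lemma dmono_deriv_add:
  "(dmono_deriv (M + N) :: 'a::comm_semiring_1 dpoly) =
     single N 1 * dmono_deriv M + single M 1 * dmono_deriv N"
proof -
  let ?A = "keys M \<union> keys N"
  let ?m = "\<lambda>M j. M - single j 1 + single (Suc j) (1::nat)"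
  have step: "single (?m (M + N) j) (of_nat (lookup M j) :: 'a fps) =
      single N 1 * single (?m M j) (of_nat (lookup M j))" for M N j
  proof (cases "lookup M j = 0")
    case False
    then have "?m (M + N) j = N + ?m M j"
      by (intro poly_mapping_eqI) (auto simp: lookup_add lookup_minus lookup_single when_def)
    then show ?thesis by (simp add: mult_single)
  qed simp
  have "dmono_deriv (M + N) =
      (\<Sum>j\<in>?A. single (?m (M + N) j) (of_nat (lookup (M + N) j) :: 'a fps))"
    by (rule dmono_deriv_superset) (use keys_add[of M N] in auto)
  also have "\<dots> = (\<Sum>j\<in>?A. single (?m (M + N) j) (of_nat (lookup M j) :: 'a fps))
      + (\<Sum>j\<in>?A. single (?m (N + M) j) (of_nat (lookup N j) :: 'a fps))"
    by (simp add: lookup_add single_add sum.distrib add.commute)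
  also have "\<dots> = single N 1 * dmono_deriv M + single M 1 * dmono_deriv N"
    unfolding step sum_distrib_left[symmetric]
    using dmono_deriv_superset[of ?A M, where 'a='a] dmono_deriv_superset[of ?A N, where 'a='a]
    by simp
  finally show ?thesis .
qed

lemma dpoly_sum_monomials: "(\<Sum>M\<in>keys P. single M (lookup P M)) = P"
  by (intro poly_mapping_eqI)
    (simp add: lookup_sum lookup_single when_def in_keys_iff sum.delta)

lemma fps_deriv_mult':
  fixes a b :: "'a::comm_ring_1 fps"
  shows "fps_deriv (a * b) = fps_deriv a * b + a * fps_deriv b"
  by (simp add: fps_deriv_mult algebra_simps)

lemma dderiv_mult:
  fixes P Q :: "'a::comm_ring_1 dpoly"
  shows "dderiv (P * Q) = dderiv P * Q + P * dderiv Q"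
proof -
  let ?s = "\<lambda>P M. single M (lookup P M)"
  have split: "single M a = dconst a * single M 1"
    for M and a :: "'a fps"
    by (simp add: dconst_def mult_single)
  have mono: "dderiv (single M a * single N b) =
      dderiv (single M a) * single N b
      + single M a * dderiv (single N b)" for M N and a b :: "'a fps"
  proof -
    have "dderiv (single M a * single N b) =
        single (M + N) (fps_deriv a * b + a * fps_deriv b)
        + dconst (a * b) * (single N 1 * dmono_deriv M
                            + single M 1 * dmono_deriv N)"
      by (simp add: mult_single dderiv_single dmono_deriv_add fps_deriv_mult' del: fps_deriv_mult)
    also have "\<dots> = single M (fps_deriv a) * single N b
        + single M a * single N (fps_deriv b)
        + (dconst a * dmono_deriv M) * (dconst b * single N 1)
        + (dconst a * single M 1) * (dconst b * dmono_deriv N)"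
    proof -
      have "dconst (a * b) = dconst a * (dconst b :: 'a dpoly)"
        by (simp add: dconst_def mult_single)
      then show ?thesis by (simp add: mult_single single_add algebra_simps)
    qed
    also have "\<dots> = dderiv (single M a) * single N b
        + single M a * dderiv (single N b)"
      unfolding split[of M a, symmetric] split[of N b, symmetric]
      by (simp add: dderiv_single algebra_simps)
    finally show ?thesis .
  qed
  have "dderiv ((\<Sum>M\<in>keys P. ?s P M) * (\<Sum>N\<in>keys Q. ?s Q N)) =
      dderiv (\<Sum>M\<in>keys P. ?s P M) * (\<Sum>N\<in>keys Q. ?s Q N)
      + (\<Sum>M\<in>keys P. ?s P M) * dderiv (\<Sum>N\<in>keys Q. ?s Q N)"
    by (simp add: sum_product dderiv_sum mono sum.distrib)
  then show ?thesis by (simp add: dpoly_sum_monomials)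
qed

lemma dderiv_dconst: "dderiv (dconst a) = dconst (fps_deriv a)"
  unfolding dconst_def[of a] dderiv_single by (simp add: dmono_deriv_def dconst_def)

lemma dderiv_dvar: "dderiv (dvar j) = (dvar (Suc j) :: 'a::comm_semiring_1 dpoly)"
proof -
  have "fps_deriv (1 :: 'a fps) = 0" by (simp add: fps_eq_iff)
  then show ?thesis
    unfolding dvar_def dderiv_single by (simp add: dmono_deriv_def dconst_def mult_single)
qed

section \<open>Boolean power series\<close>

text \<open>
  \<open>BB[[t]]\<close> is the semiring of formal power series over the Boolean semifield, with the library's
  sum, product and formal derivative. The lemmas below confirm that under the identification with
  subsets of \<open>\<nat>\<close> these are union, Minkowski sum and \<open>S \<mapsto> {j - 1 | j \<in> S, j > 0}\<close>.
\<close>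

datatype boolean = BZero | BOne

instantiation boolean :: comm_semiring_1
begin

definition zero_boolean :: boolean where "0 = BZero"
definition one_boolean :: boolean where "1 = BOne"
definition plus_boolean :: "boolean \<Rightarrow> boolean \<Rightarrow> boolean" where
  "a + b = (if a = BZero \<and> b = BZero then BZero else BOne)"
definition times_boolean :: "boolean \<Rightarrow> boolean \<Rightarrow> boolean" where
  "a * b = (if a = BOne \<and> b = BOne then BOne else BZero)"

instance
proof
  fix a b c :: boolean
  show "a + b + c = a + (b + c)" "a + b = b + a" "0 + a = a" "a * b * c = a * (b * c)"
    "a * b = b * a" "1 * a = a" "(a + b) * c = a * c + b * c" "0 * a = 0" "a * 0 = 0"
    "(0::boolean) \<noteq> 1"
    by (cases a; cases b; cases c;
        simp add: zero_boolean_def one_boolean_def plus_boolean_def times_boolean_def)+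
qed

end

lemma boolean_neq_0_iff: "(a::boolean) \<noteq> 0 \<longleftrightarrow> a = 1"
  by (cases a) (simp_all add: zero_boolean_def one_boolean_def)

lemma boolean_add_eq_0_iff: "(a::boolean) + b = 0 \<longleftrightarrow> a = 0 \<and> b = 0"
  by (auto simp: zero_boolean_def plus_boolean_def)

lemma boolean_mult_eq_0_iff: "(a::boolean) * b = 0 \<longleftrightarrow> a = 0 \<or> b = 0"
  by (cases a; cases b) (simp_all add: zero_boolean_def times_boolean_def)

lemma boolean_sum_eq_0_iff:
  "finite A \<Longrightarrow> (\<Sum>i\<in>A. f i :: boolean) = 0 \<longleftrightarrow> (\<forall>i\<in>A. f i = 0)"
  by (induction A rule: finite_induct) (simp_all add: boolean_add_eq_0_iff)

text \<open>Support of a power series; on Boolean series it is the identification with subsets of \<open>\<nat>\<close>.\<close>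

definition supp :: "'a::zero fps \<Rightarrow> nat set" where
  "supp w = {j. fps_nth w j \<noteq> 0}"

definition bseries :: "nat set \<Rightarrow> boolean fps" where
  "bseries S = Abs_fps (\<lambda>j. if j \<in> S then 1 else 0)"

lemma supp_bseries [simp]: "supp (bseries S) = S"
  by (simp add: supp_def bseries_def)

lemma bseries_supp [simp]: "bseries (supp a) = a"
  using boolean_neq_0_iff by (auto simp: fps_eq_iff supp_def bseries_def)

lemma supp_0 [simp]: "supp 0 = {}"
  by (simp add: supp_def)

lemma supp_1: "supp (1 :: boolean fps) = {0}"
  by (auto simp: supp_def)

lemma supp_add: "supp (a + b :: boolean fps) = supp a \<union> supp b"
  by (auto simp: supp_def boolean_add_eq_0_iff)

lemma supp_mult: "supp (a * b :: boolean fps) = {i + j | i j. i \<in> supp a \<and> j \<in> supp b}"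
proof -
  have "n \<in> supp (a * b) \<longleftrightarrow> (\<exists>i\<in>{0..n}. i \<in> supp a \<and> n - i \<in> supp b)" for n
    by (auto simp: supp_def fps_mult_nth boolean_sum_eq_0_iff boolean_mult_eq_0_iff)
  moreover have "(\<exists>i\<in>{0..n}. i \<in> supp a \<and> n - i \<in> supp b) \<longleftrightarrow>
      (\<exists>i j. n = i + j \<and> i \<in> supp a \<and> j \<in> supp b)" for n
  proof
    assume "\<exists>i\<in>{0..n}. i \<in> supp a \<and> n - i \<in> supp b"
    then obtain i where "i \<le> n" "i \<in> supp a" "n - i \<in> supp b" by auto
    then show "\<exists>i j. n = i + j \<and> i \<in> supp a \<and> j \<in> supp b"
      by (intro exI[of _ i] exI[of _ "n - i"]) simp
  qed auto
  ultimately show ?thesis by blast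
qed

lemma supp_fps_deriv: "supp (fps_deriv a :: boolean fps) = {j - 1 | j. j \<in> supp a \<and> j > 0}"
proof -
  have "of_nat (Suc n) = (1::boolean)" for n
    by (induction n) (simp_all add: one_boolean_def plus_boolean_def)
  then have "fps_nth (fps_deriv a) n = fps_nth a (Suc n)" for n
    by (simp del: of_nat_Suc)
  then have "n \<in> supp (fps_deriv a) \<longleftrightarrow> Suc n \<in> supp a" for n
    by (simp add: supp_def)
  moreover have "Suc n \<in> supp a \<longleftrightarrow> n \<in> {j - 1 | j. j \<in> supp a \<and> j > 0}" for n
    by (auto intro: exI[of _ "Suc n"])
  ultimately show ?thesis by blast
qed

section \<open>The quotient by equality of Newton polyhedra\<close>

definition newton :: "nat set \<Rightarrow> real set" where
  "newton A = convex hull (real ` {i + j | i j. i \<in> A})"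

lemma of_nat_in_newton_iff: "real n \<in> newton A \<longleftrightarrow> (\<exists>i\<in>A. i \<le> n)"
proof
  assume n: "real n \<in> newton A"
  show "\<exists>i\<in>A. i \<le> n"
  proof (rule ccontr)
    assume "\<not> ?thesis"
    then have "real ` {i + j | i j. i \<in> A} \<subseteq> {real n <..}"
      by fastforce
    then have "newton A \<subseteq> {real n <..}"
      unfolding newton_def by (rule hull_minimal) (rule convex_real_interval)
    with n show False by auto
  qed
next
  assume "\<exists>i\<in>A. i \<le> n"
  then obtain i where "i \<in> A" "n = i + (n - i)" by auto
  then have "n \<in> {i + j | i j. i \<in> A}" by blast
  then show "real n \<in> newton A"
    unfolding newton_def by (intro hull_inc imageI)
qed

lemma newton_eq_iff: "newton A = newton B \<longleftrightarrow> (\<forall>n. (\<exists>i\<in>A. i \<le> n) \<longleftrightarrow> (\<exists>i\<in>B. i \<le> n))"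
proof
  assume "newton A = newton B"
  then show "\<forall>n. (\<exists>i\<in>A. i \<le> n) \<longleftrightarrow> (\<exists>i\<in>B. i \<le> n)"
    by (simp flip: of_nat_in_newton_iff)
next
  assume eq: "\<forall>n. (\<exists>i\<in>A. i \<le> n) \<longleftrightarrow> (\<exists>i\<in>B. i \<le> n)"
  have "{i + j | i j. i \<in> C} = {n. \<exists>i\<in>C. i \<le> n}" for C :: "nat set"
    unfolding le_iff_add by blast
  with eq show "newton A = newton B" by (simp add: newton_def)
qed

definition newton_equiv :: "boolean fps \<Rightarrow> boolean fps \<Rightarrow> bool" where
  "newton_equiv a b \<longleftrightarrow> newton (supp a) = newton (supp b)"

quotient_type vseries = "boolean fps" / newton_equiv
  by (rule equivpI) (auto simp: newton_equiv_def intro!: reflpI sympI transpI)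

instantiation vseries :: comm_semiring_1
begin

lift_definition zero_vseries :: vseries is 0 .
lift_definition one_vseries :: vseries is 1 .
lift_definition plus_vseries :: "vseries \<Rightarrow> vseries \<Rightarrow> vseries" is "(+)"
  unfolding newton_equiv_def newton_eq_iff supp_add by (auto simp: bex_Un)
lift_definition times_vseries :: "vseries \<Rightarrow> vseries \<Rightarrow> vseries" is "(*)"
proof -
  fix a b c d :: "boolean fps"
  assume eq: "newton_equiv a b" "newton_equiv c d"
  have imp: "\<exists>k\<in>supp (b * d). k \<le> n"
    if ab: "newton_equiv a b" "newton_equiv c d" and ac: "\<exists>k\<in>supp (a * c). k \<le> n" for a b c d n
  proof -
    from ac obtain i j where ij: "i \<in> supp a" "j \<in> supp c" "i + j \<le> n"
      by (auto simp: supp_mult)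
    from ab ij(1,2) obtain i' j' where "i' \<in> supp b" "i' \<le> i" "j' \<in> supp d" "j' \<le> j"
      unfolding newton_equiv_def newton_eq_iff by (meson order_refl)
    with ij(3) show ?thesis
      by (intro bexI[of _ "i' + j'"]) (auto simp: supp_mult)
  qed
  have "newton_equiv b a" "newton_equiv d c"
    using eq by (simp_all add: newton_equiv_def)
  with eq imp show "newton_equiv (a * c) (b * d)"
    unfolding newton_equiv_def[of "a * c"] newton_eq_iff by blast
qed

instance
proof
  fix a b c :: vseries
  show "a + b + c = a + (b + c)" "a + b = b + a" "0 + a = a" "a * b * c = a * (b * c)"
    "a * b = b * a" "1 * a = a" "(a + b) * c = a * c + b * c" "0 * a = 0" "a * 0 = 0"
    by (transfer; simp add: newton_equiv_def algebra_simps)+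
  show "(0::vseries) \<noteq> 1"
    by transfer (auto simp: newton_equiv_def newton_eq_iff supp_1)
qed

end

lift_definition V :: "boolean fps \<Rightarrow> vseries" is "\<lambda>a. a" .

lemma V_eq_iff: "V a = V b \<longleftrightarrow> newton (supp a) = newton (supp b)"
  by transfer (simp add: newton_equiv_def)

lemma V_hom: "V 0 = 0" "V 1 = 1" "V (a + b) = V a + V b" "V (a * b) = V a * V b"
  by (transfer; simp add: newton_equiv_def)+

section \<open>Tropical solutions\<close>

text \<open>
  The sum is indexed by the monomials with nonzero coefficient; the others would contribute \<open>V 0 = 0\<close>.
\<close>

definition trop_vanishes :: "'i set \<Rightarrow> ('i \<Rightarrow> vseries) \<Rightarrow> bool" where
  "trop_vanishes A f \<longleftrightarrow> (\<forall>i\<in>A. sum f (A - {i}) = sum f A)"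

definition trop_solution :: "boolean dpoly \<Rightarrow> boolean fps \<Rightarrow> bool" where
  "trop_solution p \<phi> \<longleftrightarrow> trop_vanishes (keys p) (\<lambda>M. V (lookup p M * dmono_eval M \<phi>))"

definition trop :: "'a::zero dpoly \<Rightarrow> boolean dpoly" where
  "trop P = Poly_Mapping.map (\<lambda>a. bseries (supp a)) P"

lemma lookup_trop: "lookup (trop P) M = bseries (supp (lookup P M))"
proof -
  have "bseries {} = 0" by (simp add: fps_eq_iff bseries_def)
  then show ?thesis
    by (simp add: trop_def Poly_Mapping.map.rep_eq when_def)
qed

definition TropSol :: "boolean dpoly set \<Rightarrow> nat set set" where
  "TropSol S = {A. \<forall>p\<in>S. trop_solution p (bseries A)}"

section \<open>Scrawls of (possibly infinite) matroids\<close>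

text \<open>
  Matroids on arbitrary ground sets, in terms of independent sets, with the axioms of Bruhn,
  Diestel, Kriesell, Pendavingh and Wollan. For finite ground sets these are the usual matroids.
\<close>

definition maximal_in :: "'a set set \<Rightarrow> 'a set \<Rightarrow> bool" where
  "maximal_in F A \<longleftrightarrow> A \<in> F \<and> (\<forall>B\<in>F. A \<subseteq> B \<longrightarrow> B = A)"

definition matroid :: "'a set \<Rightarrow> 'a set set \<Rightarrow> bool" where
  "matroid E Ind \<longleftrightarrow>
     Ind \<subseteq> Pow E \<and> {} \<in> Ind \<and>
     (\<forall>A\<in>Ind. \<forall>B\<subseteq>A. B \<in> Ind) \<and>
     (\<forall>A\<in>Ind. \<forall>B. \<not> maximal_in Ind A \<longrightarrow> maximal_in Ind B \<longrightarrow> (\<exists>x\<in>B - A. insert x A \<in> Ind)) \<and>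
     (\<forall>A\<in>Ind. \<forall>X. A \<subseteq> X \<longrightarrow> X \<subseteq> E \<longrightarrow> (\<exists>B. maximal_in {C\<in>Ind. A \<subseteq> C \<and> C \<subseteq> X} B))"

definition circuits :: "'a set \<Rightarrow> 'a set set \<Rightarrow> 'a set set" where
  "circuits E Ind = {C. C \<subseteq> E \<and> C \<notin> Ind \<and> (\<forall>B. B \<subset> C \<longrightarrow> B \<in> Ind)}"

definition scrawls :: "'a set \<Rightarrow> 'a set set \<Rightarrow> 'a set set" where
  "scrawls E Ind = {\<Union>F | F. F \<subseteq> circuits E Ind}"

end

theory Submission
  imports Defs
begin

text \<open>
  Prescribe two series \<open>x = 1 + 0 t + t\<^sup>2 + t\<^sup>3 + \<dots>\<close> and \<open>z = 0 + t + z\<^sub>2 t\<^sup>2 + z\<^sub>3 t\<^sup>3 + \<dots>\<close>,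
  where \<open>z\<^sub>2, z\<^sub>3, \<dots>\<close> enumerates the nonzero elements of the countable field. Their Wronskian has
  constant term \<open>1\<close>, so it is a unit and \<open>x\<close>, \<open>z\<close> satisfy a common equation
  \<open>y'' + \<gamma> y' + \<beta> y = 0\<close> (lemma \<open>exists_second_order_ode\<close>); its solutions are exactly the
  combinations \<open>c x + d z\<close> (lemma \<open>ode_solution_combination\<close>). The supports of \<open>x\<close> and \<open>z\<close> are
  \<open>\<nat> - {1}\<close> and \<open>\<nat> - {0}\<close>, with union \<open>\<nat>\<close>. But \<open>c x + d z\<close> has coefficients \<open>c\<close>, \<open>d\<close> in degrees
  \<open>0\<close>, \<open>1\<close>, and if both are nonzero, its coefficient \<open>c + d z\<^sub>n\<close> vanishes for the \<open>n\<close> with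
  \<open>z\<^sub>n = - c / d\<close>. So no solution has full support.

  On the tropical side, every monomial evaluates at \<open>\<nat>\<close> to an element with trivial image under \<open>V\<close>,
  so \<open>\<nat>\<close> solves \<open>trop P\<close> as soon as no coefficient of \<open>P\<close> has strictly smaller order than all the
  others (lemma \<open>UNIV_trop_solution\<close>). For \<open>P\<close> in the differential ideal this holds without
  extending the field: if the coefficient of \<open>E\<^sub>M\<close> alone had minimal order \<open>m\<close>, then, since \<open>P\<close>
  vanishes at all solutions (lemma \<open>deval_diff_ideal_span\<close>), the constant term of \<open>E\<^sub>M(w)\<close>, and with
  it one of the finitely many coefficients \<open>w\<^sub>j\<close>, \<open>j\<close> in the support of \<open>M\<close>, would vanish for each
  solution \<open>w\<close>. But \<open>x + d z\<close> avoids finitely many such zeros for a suitable \<open>d\<close>, because the field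
  is infinite.
\<close>

section \<open>Evaluation as a differential homomorphism\<close>

lemma dmono_eval_superset:
  assumes "finite A" "keys M \<subseteq> A"
  shows "dmono_eval M w = (\<Prod>j\<in>A. ((fps_deriv ^^ j) w) ^ lookup M j)"
  unfolding dmono_eval_def
  by (rule prod.mono_neutral_left) (use assms in \<open>auto simp: in_keys_iff\<close>)

lemma dmono_eval_add: "dmono_eval (M + N) w = dmono_eval M w * dmono_eval N w"
proof -
  let ?A = "keys M \<union> keys N"
  have "dmono_eval (M + N) w = (\<Prod>j\<in>?A. ((fps_deriv ^^ j) w) ^ lookup (M + N) j)"
    by (rule dmono_eval_superset) (use keys_add[of M N] in auto)
  also have "\<dots> = dmono_eval M w * dmono_eval N w"
    using dmono_eval_superset[of ?A M w] dmono_eval_superset[of ?A N w]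
    by (simp add: lookup_add power_add prod.distrib)
  finally show ?thesis .
qed

lemma deval_superset:
  assumes "finite A" "keys P \<subseteq> A"
  shows "deval P w = (\<Sum>M\<in>A. lookup P M * dmono_eval M w)"
  unfolding deval_def
  by (rule sum.mono_neutral_left) (use assms in \<open>auto simp: in_keys_iff\<close>)

lemma deval_0 [simp]: "deval 0 w = 0"
  by (simp add: deval_def)

lemma deval_single [simp]: "deval (single M a) w = a * dmono_eval M w"
  by (cases "a = 0") (simp_all add: deval_def)

lemma deval_add [simp]: "deval (P + Q) w = deval P w + deval Q w"
proof -
  let ?A = "keys P \<union> keys Q"
  have "deval (P + Q) w = (\<Sum>M\<in>?A. lookup (P + Q) M * dmono_eval M w)"
    by (rule deval_superset) (use keys_add[of P Q] in auto)
  then show ?thesis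
    using deval_superset[of ?A P w] deval_superset[of ?A Q w]
    by (simp add: lookup_add algebra_simps sum.distrib)
qed

lemma deval_sum: "deval (\<Sum>i\<in>A. f i) w = (\<Sum>i\<in>A. deval (f i) w)"
  by (induction A rule: infinite_finite_induct) simp_all

lemma deval_mult [simp]: "deval (P * Q) w = deval P w * deval Q w"
proof -
  have "P * Q = (\<Sum>M\<in>keys P. \<Sum>N\<in>keys Q. single (M + N) (lookup P M * lookup Q N))"
    using arg_cong2[OF dpoly_sum_monomials[of P] dpoly_sum_monomials[of Q], of "(*)"]
    by (simp add: sum_product mult_single)
  also have "deval \<dots> w = deval P w * deval Q w"
    by (simp add: deval_sum dmono_eval_add deval_def[of P] deval_def[of Q] sum_product algebra_simps)
  finally show ?thesis .
qed

lemma deval_dconst [simp]: "deval (dconst a) w = a"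
  by (simp add: dconst_def dmono_eval_def)

lemma deval_dvar [simp]: "deval (dvar j) w = (fps_deriv ^^ j) w"
  by (simp add: dvar_def dmono_eval_def)

text \<open>
  Both sides satisfy the same Leibniz rule in \<open>M\<close>, so it suffices to compare them on the exponent
  vectors of the single variables \<open>y^(j)\<close>, which generate the additive monoid of exponent vectors.
\<close>

lemma deval_dmono_deriv:
  fixes w :: "'a::comm_ring_1 fps"
  shows "deval (dmono_deriv M) w = fps_deriv (dmono_eval M w)"
proof -
  have unit: "deval (dmono_deriv (single j 1)) w = fps_deriv (dmono_eval (single j 1) w)" for j
    by (simp add: dmono_deriv_def dmono_eval_def)
  have power: "deval (dmono_deriv (single j n)) w = fps_deriv (dmono_eval (single j n) w)" for j n
  proof (induction n)
    case 0
    show ?case by (simp add: dmono_deriv_def dmono_eval_def)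
  next
    case (Suc n)
    have "single j (Suc n) = single j n + single j 1"
      by (simp flip: single_add)
    then show ?case
      using Suc unit[of j]
      by (simp add: dmono_deriv_add dmono_eval_add fps_deriv_mult' algebra_simps
          del: One_nat_def fps_deriv_mult)
  qed
  have "deval (dmono_deriv (\<Sum>j\<in>A. single j (lookup M j))) w
      = fps_deriv (dmono_eval (\<Sum>j\<in>A. single j (lookup M j)) w)" if "finite A" for A
    using that
  proof (induction A rule: finite_induct)
    case empty
    show ?case by (simp add: dmono_deriv_def dmono_eval_def)
  next
    case (insert i A)
    then show ?case
      by (simp add: dmono_deriv_add dmono_eval_add power fps_deriv_mult' algebra_simps
          del: fps_deriv_mult)
  qed
  moreover have "(\<Sum>j\<in>keys M. single j (lookup M j)) = M"
    by (intro poly_mapping_eqI)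
      (simp add: lookup_sum lookup_single when_def in_keys_iff sum.delta)
  ultimately show ?thesis
    by (metis finite_keys)
qed

lemma deval_dderiv:
  fixes w :: "'a::comm_ring_1 fps"
  shows "deval (dderiv P) w = fps_deriv (deval P w)"
proof -
  have "fps_deriv (\<Sum>M\<in>A. f M) = (\<Sum>M\<in>A. fps_deriv (f M))" for A and f :: "dmono \<Rightarrow> 'a fps"
    by (induction A rule: infinite_finite_induct) simp_all
  then show ?thesis
    by (simp add: dderiv_def deval_sum deval_dmono_deriv deval_def[of P] fps_deriv_mult' algebra_simps
        del: fps_deriv_mult)
qed

lemma deval_diff_ideal_span:
  fixes S :: "'a::comm_ring_1 dpoly set"
  assumes "w \<in> Sol S" "P \<in> diff_ideal_span S"
  shows "deval P w = 0"
proof -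
  have "diff_ideal {P. deval P w = 0}"
    by (simp add: diff_ideal_def deval_dderiv)
  moreover have "S \<subseteq> {P. deval P w = 0}"
    using assms(1) by (auto simp: Sol_def)
  ultimately have "diff_ideal_span S \<subseteq> {P. deval P w = 0}"
    unfolding diff_ideal_span_def by (intro hull_minimal)
  with assms(2) show ?thesis by blast
qed

section \<open>The full set as a tropical solution\<close>

lemma V_power: "V (a ^ n) = V a ^ n"
  by (induction n) (simp_all add: V_hom)

lemma V_prod: "V (\<Prod>i\<in>A. f i) = (\<Prod>i\<in>A. V (f i))"
  by (induction A rule: infinite_finite_induct) (simp_all add: V_hom)

lemma V_bseries_UNIV: "V (bseries UNIV) = 1"
  by (simp add: V_hom(2)[symmetric] V_eq_iff newton_eq_iff supp_1) auto

lemma fps_deriv_bseries_UNIV: "fps_deriv (bseries UNIV) = bseries UNIV"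
proof -
  have "n \<in> supp (fps_deriv (bseries UNIV))" for n
    unfolding supp_fps_deriv by (auto intro: exI[of _ "Suc n"])
  then have "supp (fps_deriv (bseries UNIV)) = UNIV" by blast
  then show ?thesis by (metis bseries_supp)
qed

lemma V_dmono_eval_UNIV: "V (dmono_eval M (bseries UNIV)) = 1"
proof -
  have "(fps_deriv ^^ j) (bseries UNIV) = bseries UNIV" for j
    by (induction j) (simp_all add: fps_deriv_bseries_UNIV)
  then show ?thesis
    by (simp add: dmono_eval_def V_prod V_power V_bseries_UNIV)
qed

lemma V_absorb:
  fixes a b :: "'a::comm_ring_1 fps"
  assumes "a \<noteq> 0" "subdegree a \<le> subdegree b"
  shows "V (bseries (supp b)) + V (bseries (supp a)) = V (bseries (supp a))"
proof -
  have a: "subdegree a \<in> supp a"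
    using assms(1) by (simp add: supp_def)
  have "subdegree a \<le> i" if "i \<in> supp b" for i
    using that assms(2) nth_less_subdegree_zero[of i b] by (force simp: supp_def)
  then show ?thesis
    using a by (auto simp: V_eq_iff newton_eq_iff supp_add bex_Un simp flip: V_hom(3))
      (meson order_trans)
qed

lemma UNIV_trop_solution:
  fixes P :: "'a::comm_ring_1 dpoly"
  assumes "\<And>M. M \<in> keys P \<Longrightarrow>
    \<exists>N\<in>keys P. N \<noteq> M \<and> subdegree (lookup P N) \<le> subdegree (lookup P M)"
  shows "trop_solution (trop P) (bseries UNIV)"
proof -
  define f where "f M = V (bseries (supp (lookup P M)))" for M
  have "supp a = {} \<longleftrightarrow> a = 0" for a :: "'a fps"
    by (auto simp: supp_def fps_eq_iff)
  moreover have "bseries S = 0 \<longleftrightarrow> S = {}" for S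
    by (metis bseries_supp supp_0 supp_bseries)
  ultimately have keys: "keys (trop P) = keys P"
    by (auto simp: in_keys_iff lookup_trop)
  have summand: "V (lookup (trop P) M * dmono_eval M (bseries UNIV)) = f M" for M
    by (simp add: V_hom V_dmono_eval_UNIV lookup_trop f_def)
  have "sum f (keys P - {M}) = sum f (keys P)" if M: "M \<in> keys P" for M
  proof -
    obtain N where N: "N \<in> keys P" "N \<noteq> M" "subdegree (lookup P N) \<le> subdegree (lookup P M)"
      using assms[OF M] by blast
    then have absorb: "f M + f N = f N"
      unfolding f_def by (intro V_absorb) (auto simp: in_keys_iff)
    have rest: "sum f (keys P - {M}) = f N + sum f (keys P - {M} - {N})"
      using N by (intro sum.remove) auto
    have "sum f (keys P) = f M + sum f (keys P - {M})"
      using M by (intro sum.remove) auto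
    also have "\<dots> = (f M + f N) + sum f (keys P - {M} - {N})"
      unfolding rest by (simp add: add.assoc)
    also have "\<dots> = sum f (keys P - {M})"
      unfolding rest absorb ..
    finally show ?thesis ..
  qed
  then show ?thesis
    by (simp add: trop_solution_def trop_vanishes_def keys summand)
qed

lemma fps_nth_0_dmono_eval:
  fixes w :: "'a::field_char_0 fps"
  assumes "\<And>j. j \<in> keys M \<Longrightarrow> fps_nth w j \<noteq> 0"
  shows "fps_nth (dmono_eval M w) 0 \<noteq> 0"
proof -
  have prod: "fps_nth (\<Prod>i\<in>A. f i) 0 = (\<Prod>i\<in>A. fps_nth (f i) 0)" for A and f :: "nat \<Rightarrow> 'a fps"
    by (induction A rule: infinite_finite_induct) simp_all
  show ?thesis
    using assms by (simp add: dmono_eval_def prod fps_0th_higher_deriv fps_power_zeroth)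
qed

text \<open>
  For each \<open>P\<close> only the coefficients \<open>w\<^sub>j\<close> with \<open>j\<close> in the support of a single monomial matter, so
  solutions covering every finite set of degrees suffice; none of them needs to have full support.
\<close>

lemma UNIV_in_TropSol:
  fixes S :: "'k::field_char_0 dpoly set"
  assumes "\<And>J. finite J \<Longrightarrow> \<exists>w\<in>Sol S. J \<subseteq> supp w"
  shows "UNIV \<in> TropSol (trop ` diff_ideal_span S)"
proof -
  have "\<exists>N\<in>keys P. N \<noteq> M \<and> subdegree (lookup P N) \<le> subdegree (lookup P M)"
    if P: "P \<in> diff_ideal_span S" and M: "M \<in> keys P" for P M
  proof (rule ccontr)
    assume "\<not> ?thesis"
    then have *: "subdegree (lookup P M) < subdegree (lookup P N)"
      if "N \<in> keys P" "N \<noteq> M" for N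
      using that by force
    define m where "m = subdegree (lookup P M)"
    obtain w where w: "w \<in> Sol S" "keys M \<subseteq> supp w"
      using assms[OF finite_keys] by blast
    have lowest: "fps_nth (lookup P M * dmono_eval M w) m
        = fps_nth (lookup P M) m * fps_nth (dmono_eval M w) 0"
      by (simp add: m_def fps_mult_nth_conv_upto_subdegree_left)
    have others: "fps_nth (lookup P N * dmono_eval N w) m = 0" if "N \<in> keys P" "N \<noteq> M" for N
      using *[OF that] by (intro fps_mult_nth_outside_subdegrees(1)) (simp add: m_def)
    have "fps_nth (deval P w) m = (\<Sum>N\<in>keys P. fps_nth (lookup P N * dmono_eval N w) m)"
      by (simp add: deval_def fps_sum_nth)
    also have "\<dots> = fps_nth (lookup P M * dmono_eval M w) m"
      using M others by (subst sum.remove[of _ M]) auto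
    also have "\<dots> \<noteq> 0"
    proof -
      have "fps_nth (dmono_eval M w) 0 \<noteq> 0"
        using w(2) by (intro fps_nth_0_dmono_eval) (auto simp: supp_def)
      then show ?thesis
        using M by (simp add: lowest m_def in_keys_iff)
    qed
    finally show False
      using deval_diff_ideal_span[OF w(1) P] by simp
  qed
  then show ?thesis
    unfolding TropSol_def using UNIV_trop_solution by blast
qed

section \<open>Second order linear equations\<close>

lemma exists_second_order_ode:
  fixes x z :: "'k::field fps"
  assumes "fps_nth x 0 = 1" "fps_nth x 1 = 0" "fps_nth z 0 = 0" "fps_nth z 1 = 1"
  obtains \<gamma> \<beta> where
    "fps_deriv (fps_deriv x) + \<gamma> * fps_deriv x + \<beta> * x = 0"
    "fps_deriv (fps_deriv z) + \<gamma> * fps_deriv z + \<beta> * z = 0"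
proof -
  \<comment> \<open>The coefficients come from solving for \<open>\<gamma>\<close> and \<open>\<beta>\<close> by Cramer's rule; \<open>W\<close> is the Wronskian.\<close>
  define W where "W = x * fps_deriv z - fps_deriv x * z"
  define \<gamma> where "\<gamma> = (fps_deriv (fps_deriv x) * z - x * fps_deriv (fps_deriv z)) * inverse W"
  define \<beta> where "\<beta> = (fps_deriv x * fps_deriv (fps_deriv z)
    - fps_deriv (fps_deriv x) * fps_deriv z) * inverse W"
  have "fps_nth W 0 = 1"
    using assms by (simp add: W_def)
  then have W: "inverse W * W = 1"
    by (intro inverse_mult_eq_1) simp
  have "fps_deriv (fps_deriv x) + \<gamma> * fps_deriv x + \<beta> * x = 0"
  proof -
    have "fps_deriv (fps_deriv x) = fps_deriv (fps_deriv x) * (inverse W * W)"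
      by (simp add: W)
    then show ?thesis
      unfolding \<gamma>_def \<beta>_def by (simp only: W_def) (simp add: algebra_simps)
  qed
  moreover have "fps_deriv (fps_deriv z) + \<gamma> * fps_deriv z + \<beta> * z = 0"
  proof -
    have "fps_deriv (fps_deriv z) = fps_deriv (fps_deriv z) * (inverse W * W)"
      by (simp add: W)
    then show ?thesis
      unfolding \<gamma>_def \<beta>_def by (simp only: W_def) (simp add: algebra_simps)
  qed
  ultimately show thesis by (rule that)
qed

lemma ode_unique_zero:
  fixes u :: "'k::field_char_0 fps"
  assumes ode: "fps_deriv (fps_deriv u) + \<gamma> * fps_deriv u + \<beta> * u = 0"
    and init: "fps_nth u 0 = 0" "fps_nth u 1 = 0"
  shows "u = 0"
proof -
  have "fps_nth u n = 0" for n
  proof (induction n rule: less_induct)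
    case (less n)
    show ?case
    proof (cases "n < 2")
      case True
      then show ?thesis
        using init by (auto simp: less_2_cases_iff)
    next
      case False
      then obtain k where n: "n = Suc (Suc k)"
        by (metis add_2_eq_Suc le_Suc_ex not_less)
      have "fps_nth (\<gamma> * fps_deriv u) k = 0" "fps_nth (\<beta> * u) k = 0"
        unfolding fps_mult_nth by (intro sum.neutral; simp add: less n)+
      moreover have "fps_nth (fps_deriv (fps_deriv u) + \<gamma> * fps_deriv u + \<beta> * u) k = 0"
        by (simp add: ode)
      ultimately have "of_nat (Suc k) * (of_nat (Suc (Suc k)) * fps_nth u n) = 0"
        by (simp add: n)
      then show ?thesis
        by (simp del: of_nat_Suc)
    qed
  qed
  then show ?thesis by (simp add: fps_eq_iff)
qed

lemma ode_solution_combination: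
  fixes x z :: "'k::field_char_0 fps"
  assumes init: "fps_nth x 0 = 1" "fps_nth x 1 = 0" "fps_nth z 0 = 0" "fps_nth z 1 = 1"
    and x: "fps_deriv (fps_deriv x) + \<gamma> * fps_deriv x + \<beta> * x = 0"
    and z: "fps_deriv (fps_deriv z) + \<gamma> * fps_deriv z + \<beta> * z = 0"
  shows "fps_deriv (fps_deriv w) + \<gamma> * fps_deriv w + \<beta> * w = 0
    \<longleftrightarrow> (\<exists>c d. w = fps_const c * x + fps_const d * z)"
proof -
  define L where "L v = fps_deriv (fps_deriv v) + \<gamma> * fps_deriv v + \<beta> * v" for v
  have L: "L (v - (fps_const c * x + fps_const d * z)) = L v" for v c d
  proof -
    have "L (v - (fps_const c * x + fps_const d * z)) = L v - (fps_const c * L x + fps_const d * L z)"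
      by (simp add: L_def algebra_simps)
    then show ?thesis using x z by (simp add: L_def)
  qed
  have "L w = 0 \<longleftrightarrow> (\<exists>c d. w = fps_const c * x + fps_const d * z)"
  proof
    assume "L w = 0"
    define u where "u = w - (fps_const (fps_nth w 0) * x + fps_const (fps_nth w 1) * z)"
    have "L u = 0"
      unfolding u_def L by fact
    then have "u = 0"
      unfolding L_def by (rule ode_unique_zero) (use init in \<open>simp_all add: u_def\<close>)
    then show "\<exists>c d. w = fps_const c * x + fps_const d * z"
      unfolding u_def right_minus_eq by blast
  next
    assume "\<exists>c d. w = fps_const c * x + fps_const d * z"
    then obtain c d where "w - (fps_const c * x + fps_const d * z) = 0"
      unfolding right_minus_eq by (elim exE)
    then have "L w = L 0"
      using L[of w c d] by simp
    then show "L w = 0"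
      by (simp add: L_def)
  qed
  then show ?thesis
    by (simp only: L_def)
qed

section \<open>The counterexample\<close>

lemma scrawls_Un: "A \<in> scrawls E Ind \<Longrightarrow> B \<in> scrawls E Ind \<Longrightarrow> A \<union> B \<in> scrawls E Ind"
  unfolding scrawls_def by clarify (metis Un_least Union_Un_distrib)

theorem mainTheorem7:
  assumes "infinite (UNIV :: 'k::field_char_0 set)"
    and "countable (UNIV :: 'k set)"
  shows "\<exists>\<gamma> \<beta> :: 'k fps.
    let \<Sigma> = {dvar 2 + dconst \<gamma> * dvar 1 + dconst \<beta> * dvar 0} in
      \<not> (\<forall>A \<in> supp ` Sol \<Sigma>. \<forall>B \<in> supp ` Sol \<Sigma>. A \<union> B \<in> supp ` Sol \<Sigma>) \<and>
      \<not> (\<exists>Ind. matroid (UNIV :: nat set) Ind \<and> supp ` Sol \<Sigma> = scrawls UNIV Ind) \<and>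
      (UNIV :: nat set) \<in> TropSol (trop ` diff_ideal_span \<Sigma>) \<and>
      (UNIV :: nat set) \<notin> supp ` Sol \<Sigma> \<and>
      supp ` Sol \<Sigma> \<noteq> TropSol (trop ` diff_ideal_span \<Sigma>)"
proof -
  define e where "e = from_nat_into (- {0 :: 'k})"
  define x :: "'k fps" where "x = Abs_fps (\<lambda>n. if n = 1 then 0 else 1)"
  define z :: "'k fps" where "z = Abs_fps (\<lambda>n. if n = 0 then 0 else if n = 1 then 1 else e (n - 2))"
  have "countable (- {0 :: 'k})"
    using assms(2) by (rule countable_subset[rotated]) simp
  moreover have "- {0 :: 'k} \<noteq> {}"
    using one_neq_zero by blast
  ultimately have range_e: "range e = - {0}"
    unfolding e_def by (rule range_from_nat_into[rotated])
  then have e_nz: "e n \<noteq> 0" for n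
    by (metis ComplD insertI1 rangeI)
  have init: "fps_nth x 0 = 1" "fps_nth x 1 = 0" "fps_nth z 0 = 0" "fps_nth z 1 = 1"
    by (simp_all add: x_def z_def)
  obtain \<gamma> \<beta> where ode:
    "fps_deriv (fps_deriv x) + \<gamma> * fps_deriv x + \<beta> * x = 0"
    "fps_deriv (fps_deriv z) + \<gamma> * fps_deriv z + \<beta> * z = 0"
    using exists_second_order_ode[OF init] .
  define \<Sigma> where "\<Sigma> = {dvar 2 + dconst \<gamma> * dvar 1 + dconst \<beta> * dvar 0}"
  have "w \<in> Sol \<Sigma> \<longleftrightarrow> fps_deriv (fps_deriv w) + \<gamma> * fps_deriv w + \<beta> * w = 0" for w
    by (simp add: Sol_def \<Sigma>_def eval_nat_numeral)
  then have Sol_iff: "w \<in> Sol \<Sigma> \<longleftrightarrow> (\<exists>c d. w = fps_const c * x + fps_const d * z)" for w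
    by (simp add: ode_solution_combination[OF init ode])
  have "supp x = - {1}" "supp z = - {0}"
    using e_nz by (auto simp: supp_def x_def z_def)
  moreover have "x \<in> Sol \<Sigma>"
    unfolding Sol_iff by (intro exI[of _ 1] exI[of _ 0]) simp
  moreover have "z \<in> Sol \<Sigma>"
    unfolding Sol_iff by (intro exI[of _ 0] exI[of _ 1]) simp
  ultimately have mem: "- {1} \<in> supp ` Sol \<Sigma>" "- {0} \<in> supp ` Sol \<Sigma>"
    by (metis imageI)+
  have not_full: "UNIV \<notin> supp ` Sol \<Sigma>"
  proof
    assume "UNIV \<in> supp ` Sol \<Sigma>"
    then obtain c d where full: "supp (fps_const c * x + fps_const d * z) = UNIV"
      unfolding image_iff Bex_def Sol_iff by metis
    then have nz: "fps_nth (fps_const c * x + fps_const d * z) n \<noteq> 0" for n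
      by (auto simp: supp_def)
    from nz[of 0] nz[of 1] have "c \<noteq> 0" "d \<noteq> 0"
      by (simp_all add: init del: One_nat_def)
    then have "- c / d \<in> range e"
      by (simp add: range_e)
    then obtain n where "e n = - c / d"
      by force
    then have "fps_nth (fps_const c * x + fps_const d * z) (n + 2) = 0"
      using \<open>d \<noteq> 0\<close> by (simp add: x_def z_def)
    with nz show False by blast
  qed
  have not_closed: "\<not> (\<forall>A \<in> supp ` Sol \<Sigma>. \<forall>B \<in> supp ` Sol \<Sigma>. A \<union> B \<in> supp ` Sol \<Sigma>)"
  proof
    assume "\<forall>A \<in> supp ` Sol \<Sigma>. \<forall>B \<in> supp ` Sol \<Sigma>. A \<union> B \<in> supp ` Sol \<Sigma>"
    with mem have "- {1} \<union> - {0} \<in> supp ` Sol \<Sigma>" by blast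
    moreover have "- {1} \<union> - {0 :: nat} = UNIV" by auto
    ultimately show False using not_full by simp
  qed
  have trop: "UNIV \<in> TropSol (trop ` diff_ideal_span \<Sigma>)"
  proof (rule UNIV_in_TropSol)
    fix J :: "nat set"
    assume J: "finite J"
    \<comment> \<open>The coefficient of \<open>x + d z\<close> in degree \<open>j\<close> vanishes only for \<open>d = - x\<^sub>j / z\<^sub>j\<close>, or for no \<open>d\<close> when
      \<open>j = 0\<close>.\<close>
    obtain d where d: "d \<notin> (\<lambda>j. - fps_nth x j / fps_nth z j) ` J"
      using ex_new_if_finite[OF assms(1) finite_imageI[OF J]] by blast
    have "fps_nth (fps_const 1 * x + fps_const d * z) j \<noteq> 0" if "j \<in> J" for j
    proof (cases "j = 0")
      case False
      then have "fps_nth z j \<noteq> 0"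
        using e_nz by (simp add: z_def)
      moreover have "d \<noteq> - fps_nth x j / fps_nth z j"
        using d that by blast
      ultimately show ?thesis
        by (auto simp: field_simps add_eq_0_iff)
    qed (simp add: init)
    then have "J \<subseteq> supp (fps_const 1 * x + fps_const d * z)"
      unfolding supp_def by blast
    moreover have "fps_const 1 * x + fps_const d * z \<in> Sol \<Sigma>"
      unfolding Sol_iff by blast
    ultimately show "\<exists>w\<in>Sol \<Sigma>. J \<subseteq> supp w"
      by blast
  qed
  have "\<not> (\<exists>Ind. matroid (UNIV :: nat set) Ind \<and> supp ` Sol \<Sigma> = scrawls UNIV Ind)"
  proof
    assume "\<exists>Ind. matroid (UNIV :: nat set) Ind \<and> supp ` Sol \<Sigma> = scrawls UNIV Ind"
    then obtain Ind where eq: "supp ` Sol \<Sigma> = scrawls (UNIV :: nat set) Ind"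
      by (elim exE conjE)
    show False
      using not_closed unfolding eq by (simp add: scrawls_Un)
  qed
  moreover have "supp ` Sol \<Sigma> \<noteq> TropSol (trop ` diff_ideal_span \<Sigma>)"
  proof
    assume "supp ` Sol \<Sigma> = TropSol (trop ` diff_ideal_span \<Sigma>)"
    with trop not_full show False by simp
  qed
  ultimately show ?thesis
    unfolding Let_def using not_closed trop not_full
    by (intro exI[of _ \<gamma>] exI[of _ \<beta>]) (unfold \<Sigma>_def, intro conjI)
qed

end
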